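(* Let $k, q$ be positive integers with $k < q$, let $I$ be the $q \times q$ identity matrix, and let $B \in \mathbb{R}^{q \times k}$ and $A \in \mathbb{R}^{k \times q}$ be two column stochastic matrices. Then $$\lVert I - BA \rVert^2 \leq 2q.$$
   Context: All matrices are real and $\lVert M \rVert$ denotes the Frobenius norm, $\lVert M \rVert^2 = \sum_{i,j} m_{ij}^2$. A matrix is column stochastic if each of its columns has nonnegative entries summing to $1$. *)

theory Defs
  imports "HOL-Analysis.Analysis"
begin

text \<open>A matrix with \<open>m\<close> rows and \<open>n\<close> columns has type \<open>real ^ 'n ^ 'm\<close> with
  \<open>CARD('m) = m\<close> and \<open>CARD('n) = n\<close>; its entry in row \<open>i\<close> and column \<open>j\<close> is \<open>M $ i $ j\<close>.\<close>

definition column_stochastic :: "real ^ 'n ^ 'm \<Rightarrow> bool" where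
  "column_stochastic M \<longleftrightarrow>
     (\<forall>j. (\<forall>i. 0 \<le> M $ i $ j) \<and> (\<Sum>i\<in>UNIV. M $ i $ j) = 1)"

text \<open>The library norm on \<open>real ^ 'n ^ 'm\<close> is the Frobenius norm.\<close>

lemma norm_matrix_power2:
  fixes M :: "real ^ 'n ^ 'm"
  shows "(norm M)\<^sup>2 = (\<Sum>i\<in>UNIV. \<Sum>j\<in>UNIV. (M $ i $ j)\<^sup>2)"
  by (simp add: norm_vec_def L2_set_def sum_nonneg)

end

theory Submission
  imports Defs
begin

text \<open>
  Both \<open>mat 1\<close> and \<open>B ** A\<close> are column stochastic, so each column of their difference is a
  difference of two points of the standard simplex, and the squared diameter of the simplex is at
  most \<open>2\<close>. Summing over the columns gives the bound, which thus holds for the distance of any two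
  column stochastic matrices of the same shape
  (\<open>column_stochastic_diff_norm_le\<close>); stability of column stochasticity under products
  (\<open>column_stochastic_mult\<close>) makes it applicable.
\<close>

lemma column_stochastic_nonneg: "column_stochastic M \<Longrightarrow> 0 \<le> M $ i $ j"
  by (simp add: column_stochastic_def)

lemma column_stochastic_sum: "column_stochastic M \<Longrightarrow> (\<Sum>i\<in>UNIV. M $ i $ j) = 1"
  by (simp add: column_stochastic_def)

lemma column_stochastic_le_1:
  assumes "column_stochastic M"
  shows "M $ i $ j \<le> 1"
proof -
  have "M $ i $ j \<le> (\<Sum>i\<in>UNIV. M $ i $ j)"
    by (rule member_le_sum) (simp_all add: column_stochastic_nonneg[OF assms])
  then show ?thesis
    by (simp add: column_stochastic_sum[OF assms])
qed

lemma column_stochastic_mat_1: "column_stochastic (mat 1)"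
  by (simp add: column_stochastic_def mat_def)

text \<open>Column \<open>j\<close> of \<open>B ** A\<close> is the convex combination of the columns of \<open>B\<close> whose weights are
  the entries of column \<open>j\<close> of \<open>A\<close>, and the simplex is convex.\<close>

lemma column_stochastic_mult:
  fixes A :: "real ^ 'n ^ 'k" and B :: "real ^ 'k ^ 'm"
  assumes B: "column_stochastic B" and A: "column_stochastic A"
  shows "column_stochastic (B ** A)"
  unfolding column_stochastic_def
proof (intro allI conjI)
  fix i j
  show "0 \<le> (B ** A) $ i $ j"
    by (simp add: matrix_matrix_mult_def sum_nonneg column_stochastic_nonneg A B)
next
  fix j
  have "(\<Sum>i\<in>UNIV. (B ** A) $ i $ j) = (\<Sum>i\<in>UNIV. \<Sum>l\<in>UNIV. B $ i $ l * A $ l $ j)"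
    by (simp add: matrix_matrix_mult_def)
  also have "\<dots> = (\<Sum>l\<in>UNIV. \<Sum>i\<in>UNIV. B $ i $ l * A $ l $ j)"
    by (rule sum.swap)
  also have "\<dots> = (\<Sum>l\<in>UNIV. (\<Sum>i\<in>UNIV. B $ i $ l) * A $ l $ j)"
    by (simp add: sum_distrib_right)
  also have "\<dots> = 1"
    by (simp add: column_stochastic_sum A B)
  finally show "(\<Sum>i\<in>UNIV. (B ** A) $ i $ j) = 1" .
qed

text \<open>For \<open>x, y \<in> [0, 1]\<close> one has \<open>(x - y)\<^sup>2 \<le> x\<^sup>2 + y\<^sup>2 \<le> x + y\<close>; applied to the entries of a
  column, this bounds the squared length of that column of \<open>M - N\<close> by the two column sums.\<close>

lemma column_stochastic_diff_norm_le:
  fixes M N :: "real ^ 'n ^ 'm"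
  assumes M: "column_stochastic M" and N: "column_stochastic N"
  shows "(norm (M - N))\<^sup>2 \<le> 2 * real CARD('n)"
proof -
  have entry: "(x - y)\<^sup>2 \<le> x + y" if "0 \<le> x" "x \<le> 1" "0 \<le> y" "y \<le> 1" for x y :: real
  proof -
    have "(x - y)\<^sup>2 \<le> x\<^sup>2 + y\<^sup>2"
      using that by (simp add: power2_diff)
    also have "\<dots> \<le> x + y"
      using that by (intro add_mono) (simp_all add: power2_eq_square mult_left_le)
    finally show ?thesis .
  qed
  have "(norm (M - N))\<^sup>2 = (\<Sum>i\<in>UNIV. \<Sum>j\<in>UNIV. (M $ i $ j - N $ i $ j)\<^sup>2)"
    by (simp add: norm_matrix_power2)
  also have "\<dots> \<le> (\<Sum>i\<in>UNIV. \<Sum>j\<in>UNIV. M $ i $ j + N $ i $ j)"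
    by (intro sum_mono entry column_stochastic_nonneg column_stochastic_le_1 M N)
  also have "\<dots> = (\<Sum>j\<in>UNIV. \<Sum>i\<in>UNIV. M $ i $ j + N $ i $ j)"
    by (rule sum.swap)
  also have "\<dots> = 2 * real CARD('n)"
    by (simp add: sum.distrib column_stochastic_sum M N)
  finally show ?thesis .
qed

theorem lemma2:
  fixes A :: "real ^ 'q ^ 'k" and B :: "real ^ 'k ^ 'q"
  assumes "CARD('k) < CARD('q)"
    and "column_stochastic B"
    and "column_stochastic A"
  shows "(norm (mat 1 - B ** A))\<^sup>2 \<le> 2 * real CARD('q)"
  by (intro column_stochastic_diff_norm_le column_stochastic_mat_1 column_stochastic_mult assms)

end
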